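(* For $(\underline{s}_1,\underline{s}_2,\overline{s}_1,\overline{s}_2)\in\mathbb{D}$ and $i\in\{-1,0,1\}$ we have $$\mathbf{t}^{(1,i)}(\underline{s}_1,\underline{s}_2,\overline{s}_1,\overline{s}_2)=\mathbf{t}^{(1,i)}(\overline{s}_1,\underline{s}_2,\overline{s}_1,\overline{s}_2).$$
   Context: $\mathbb{R}_+=[0,\infty)$. $\mathbb{D}=\{(\underline{s}_1,\underline{s}_2,\overline{s}_1,\overline{s}_2)\in\mathbb{R}_+^2\times\mathbb{R}_+^2:\ 0<\underline{s}_1\le\overline{s}_1,\ 0<\underline{s}_2\le\overline{s}_2\}$. For $(x,y_1,y_2)\in\mathbb{R}_+\times\mathbb{R}_+^2$ and prices in $\mathbb{D}$, $\mathbb{A}(x,y_1,y_2,\underline{s}_1,\underline{s}_2,\overline{s}_1,\overline{s}_2)$ is the set of all $(l_1,l_2,m_1,m_2)\in\mathbb{R}_+^2\times\mathbb{R}_+^2$ with $0\le x+\underline{s}_1m_1+\underline{s}_2m_2-\overline{s}_1l_1-\overline{s}_2l_2$, $0\le y_i-m_i+l_i$ and $m_i\le y_i$ for $i=1,2$. $g:\mathbb{R}_+\times\mathbb{R}_+^2\to\mathbb{R}\cup\{-\infty\}$ is a fixed strictly concave function, strictly increasing with respect to each variable; $$\varphi(x,y_1,y_2,\underline{s}_1,\underline{s}_2,\overline{s}_1,\overline{s}_2,l_1,l_2,m_1,m_2)=g\big(x+\underline{s}_1m_1+\underline{s}_2m_2-\overline{s}_1l_1-\overline{s}_2l_2,\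 y_1-m_1+l_1,\ y_2-m_2+l_2\big),$$ and $\Phi(x,y_1,y_2,\underline{s}_1,\underline{s}_2,\overline{s}_1,\overline{s}_2)$ is the supremum of $\varphi$ over $(l_1,l_2,m_1,m_2)\in\mathbb{A}(x,y_1,y_2,\underline{s}_1,\underline{s}_2,\overline{s}_1,\overline{s}_2)$. For $(i_1,i_2)\in\{-1,0,1\}^2$, $\mathbb{A}^{(i_1,i_2)}(x,y_1,y_2,\underline{s}_1,\underline{s}_2,\overline{s}_1,\overline{s}_2)$ is the set of $(l_1,l_2,m_1,m_2)\in\mathbb{A}(x,y_1,y_2,\underline{s}_1,\underline{s}_2,\overline{s}_1,\overline{s}_2)$ with $i_1=\operatorname{sgn}(l_1-m_1)$, $i_2=\operatorname{sgn}(l_2-m_2)$, $l_1m_1+l_2m_2=0$ (with $\operatorname{sgn}\in\{-1,0,1\}$). The trading set $\mathbf{t}^{(i_1,i_2)}(\underline{s}_1,\underline{s}_2,\overline{s}_1,\overline{s}_2)$ is the set of $(x,y_1,y_2)\in\mathbb{R}_+\times\mathbb{R}_+^2$ for which there is $(l_1,l_2,m_1,m_2)\in\mathbb{A}^{(i_1,i_2)}(x,y_1,y_2,\underline{s}_1,\underline{s}_2,\overline{s}_1,\overline{s}_2)$ with $\Phi(x,y_1,y_2,\underline{s}_1,\underline{s}_2,\overline{s}_1,\overline{s}_2)=\varphi(x,y_1,y_2,\underline{s}_1,\underline{s}_2,\overline{s}_1,\overline{s}_2,l_1,l_2,m_1,m_2)$. Arguments are always ordered (bid 1, bid 2, ask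 1, ask 2). *)

theory Defs
  imports "HOL-Analysis.Analysis"
begin

text \<open>
  A position is a triple \<open>(x, y1, y2)\<close>: cash and holdings of the two assets. Prices are ordered
  (bid 1, bid 2, ask 1, ask 2), and a trade \<open>(l1, l2, m1, m2)\<close> buys \<open>li\<close> and sells \<open>mi\<close> of asset \<open>i\<close>.
\<close>

definition positions :: "(real \<times> real \<times> real) set" where
  "positions = {(x, y1, y2). 0 \<le> x \<and> 0 \<le> y1 \<and> 0 \<le> y2}"

definition price_domain :: "(real \<times> real \<times> real \<times> real) set" where
  "price_domain = {(b1, b2, a1, a2). 0 < b1 \<and> b1 \<le> a1 \<and> 0 < b2 \<and> b2 \<le> a2}"

text \<open>
  Objectives take values in \<open>\<real> \<union> {-\<infinity>}\<close>, modelled as functions into \<^typ>\<open>ereal\<close> that avoid \<open>\<infinity>\<close>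
  on \<^const>\<open>positions\<close>; there \<open>t * (-\<infinity>) = -\<infinity>\<close> for \<open>t > 0\<close>, and a sum with a summand \<open>-\<infinity>\<close>
  is \<open>-\<infinity>\<close>. Values outside \<^const>\<open>positions\<close> are never used.
\<close>

definition strictly_concave_on :: "'a::real_vector set \<Rightarrow> ('a \<Rightarrow> ereal) \<Rightarrow> bool" where
  "strictly_concave_on S f \<longleftrightarrow> convex S \<and>
     (\<forall>u\<in>S. \<forall>v\<in>S. \<forall>t::real. u \<noteq> v \<longrightarrow> 0 < t \<longrightarrow> t < 1 \<longrightarrow>
        ereal t * f u + ereal (1 - t) * f v < f (t *\<^sub>R u + (1 - t) *\<^sub>R v))"

definition strictly_increasing_each :: "(real \<times> real \<times> real \<Rightarrow> ereal) \<Rightarrow> bool" where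
  "strictly_increasing_each g \<longleftrightarrow>
     (\<forall>y1\<ge>0. \<forall>y2\<ge>0. strict_mono_on {0..} (\<lambda>x. g (x, y1, y2))) \<and>
     (\<forall>x\<ge>0. \<forall>y2\<ge>0. strict_mono_on {0..} (\<lambda>y1. g (x, y1, y2))) \<and>
     (\<forall>x\<ge>0. \<forall>y1\<ge>0. strict_mono_on {0..} (\<lambda>y2. g (x, y1, y2)))"

type_synonym quad = "real \<times> real \<times> real \<times> real"

fun admissible :: "real \<times> real \<times> real \<Rightarrow> quad \<Rightarrow> quad set" where
  "admissible (x, y1, y2) (b1, b2, a1, a2) =
     {(l1, l2, m1, m2). 0 \<le> l1 \<and> 0 \<le> l2 \<and> 0 \<le> m1 \<and> 0 \<le> m2 \<and>
        0 \<le> x + b1 * m1 + b2 * m2 - a1 * l1 - a2 * l2 \<and>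
        0 \<le> y1 - m1 + l1 \<and> 0 \<le> y2 - m2 + l2 \<and> m1 \<le> y1 \<and> m2 \<le> y2}"

fun payoff :: "(real \<times> real \<times> real \<Rightarrow> ereal) \<Rightarrow> real \<times> real \<times> real \<Rightarrow> quad \<Rightarrow> quad \<Rightarrow> ereal" where
  "payoff g (x, y1, y2) (b1, b2, a1, a2) (l1, l2, m1, m2) =
     g (x + b1 * m1 + b2 * m2 - a1 * l1 - a2 * l2, y1 - m1 + l1, y2 - m2 + l2)"

definition value_fun :: "(real \<times> real \<times> real \<Rightarrow> ereal) \<Rightarrow> real \<times> real \<times> real \<Rightarrow> quad \<Rightarrow> ereal" where
  "value_fun g z s = (SUP a \<in> admissible z s. payoff g z s a)"

fun admissible_dir :: "int \<times> int \<Rightarrow> real \<times> real \<times> real \<Rightarrow> quad \<Rightarrow> quad set" where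
  "admissible_dir (i1, i2) z s =
     {(l1, l2, m1, m2). (l1, l2, m1, m2) \<in> admissible z s \<and>
        real_of_int i1 = sgn (l1 - m1) \<and> real_of_int i2 = sgn (l2 - m2) \<and>
        l1 * m1 + l2 * m2 = 0}"

definition trading_set ::
  "(real \<times> real \<times> real \<Rightarrow> ereal) \<Rightarrow> int \<times> int \<Rightarrow> quad \<Rightarrow> (real \<times> real \<times> real) set" where
  "trading_set g i s =
     {z \<in> positions. \<exists>a \<in> admissible_dir i z s. value_fun g z s = payoff g z s a}"

end

theory Submission
  imports Defs
begin

text \<open>
  A trade in direction \<open>(1, i)\<close> buys asset 1 and sells none of it, so neither its admissibility nor
  its payoff involves the bid price of asset 1. What has to be seen is that raising this bid
  from \<open>b1\<close> to the ask price \<open>a1\<close> does not change whether such a trade is optimal, although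
  other trades become more profitable.

  Raising the bid can only help a competitor (\<open>raise_bid1\<close>), so optimality at the bid \<open>a1\<close> implies
  optimality at the bid \<open>b1\<close>. For the other implication, suppose that some trade is strictly better
  at the bid \<open>a1\<close>. At that bid asset 1 has a single price, so a trade that buys at least as much
  of asset 1 as it sells can be netted into one without sales of asset 1, which is admissible at
  the bid \<open>b1\<close> and leads to the same portfolio (\<open>net_asset1\<close>). If the better trade sells more of
  asset 1 than it buys, then some convex combination of it with the given purchase has net trade
  zero in asset 1. By concavity this combination is still strictly better than the given trade
  (\<open>strictly_concave_on_improves\<close>), and now netting applies to it.
\<close>

fun portfolio_after :: "real \<times> real \<times> real \<Rightarrow> quad \<Rightarrow> quad \<Rightarrow> real \<times> real \<times> real" where
  "portfolio_after (x, y1, y2) (b1, b2, a1, a2) (l1, l2, m1, m2) =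
     (x + b1 * m1 + b2 * m2 - a1 * l1 - a2 * l2, y1 - m1 + l1, y2 - m2 + l2)"

definition optimal_trade ::
  "(real \<times> real \<times> real \<Rightarrow> ereal) \<Rightarrow> real \<times> real \<times> real \<Rightarrow> quad \<Rightarrow> quad \<Rightarrow> bool" where
  "optimal_trade g z s a \<longleftrightarrow>
     a \<in> admissible z s \<and> (\<forall>a' \<in> admissible z s. payoff g z s a' \<le> payoff g z s a)"

lemma payoff_eq_portfolio_after: "payoff g z s a = g (portfolio_after z s a)"
  by (cases z; cases s; cases a) auto

lemma portfolio_after_in_positions:
  "a \<in> admissible z s \<Longrightarrow> portfolio_after z s a \<in> positions"
  by (cases z; cases s; cases a) (auto simp: positions_def)

lemma value_fun_eq_payoff_iff_optimal_trade:
  assumes "a \<in> admissible z s"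
  shows "value_fun g z s = payoff g z s a \<longleftrightarrow> optimal_trade g z s a"
proof
  assume "value_fun g z s = payoff g z s a"
  then show "optimal_trade g z s a"
    using assms unfolding optimal_trade_def value_fun_def by (metis SUP_upper)
next
  assume "optimal_trade g z s a"
  then show "value_fun g z s = payoff g z s a"
    unfolding optimal_trade_def value_fun_def by (simp add: SUP_eqI)
qed

lemma convex_admissible: "convex (admissible z s)"
proof -
  obtain x y1 y2 b1 b2 a1 a2 where z: "z = (x, y1, y2)" and s: "s = (b1, b2, a1, a2)"
    by (metis prod.exhaust)
  \<comment> \<open>The admissible trades form a polyhedron: for fixed position and prices, all constraints are
    affine in the trade.\<close>
  have halfspaces: "admissible z s =
      {a. 0 \<le> fst a} \<inter> {a. 0 \<le> fst (snd a)} \<inter> {a. 0 \<le> fst (snd (snd a))} \<inter>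
      {a. 0 \<le> snd (snd (snd a))} \<inter>
      {a. - x \<le> b1 * fst (snd (snd a)) + b2 * snd (snd (snd a)) - a1 * fst a
             - a2 * fst (snd a)} \<inter>
      {a. - y1 \<le> fst a - fst (snd (snd a))} \<inter> {a. - y2 \<le> fst (snd a) - snd (snd (snd a))} \<inter>
      {a. - y1 \<le> - fst (snd (snd a))} \<inter> {a. - y2 \<le> - snd (snd (snd a))}"
    unfolding z s by auto
  have halfspace: "convex {a. c \<le> f a}" if "linear f" for c and f :: "quad \<Rightarrow> real"
    using convex_linear_vimage[OF that, of "{c..}"] by (simp add: vimage_def)
  show ?thesis
    unfolding halfspaces
    by (intro convex_Int halfspace linearI) (auto simp: algebra_simps)
qed

lemma portfolio_after_convex_combination:
  "portfolio_after z s (t *\<^sub>R a + (1 - t) *\<^sub>R a') =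
     t *\<^sub>R portfolio_after z s a + (1 - t) *\<^sub>R portfolio_after z s a'"
  by (cases z; cases s; cases a; cases a') (simp add: algebra_simps)

text \<open>
  The weighted average of the two values is at least the smaller one. This holds for infinite
  values too, since distributivity over nonnegative weights is valid in \<^typ>\<open>ereal\<close>.
\<close>
lemma strictly_concave_on_improves:
  assumes concave: "strictly_concave_on S f" and S: "u \<in> S" "v \<in> S"
    and less: "f u < f v" and t: "0 < t" "t < 1"
  shows "f u < f (t *\<^sub>R u + (1 - t) *\<^sub>R v)"
proof -
  have "f u = (ereal t + ereal (1 - t)) * f u"
    by (simp flip: one_ereal_def)
  also have "\<dots> = ereal t * f u + ereal (1 - t) * f u"
    using t by (intro ereal_left_distrib) auto
  also have "\<dots> \<le> ereal t * f u + ereal (1 - t) * f v"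
    using t less by (intro add_left_mono ereal_mult_left_mono) auto
  also have "\<dots> < f (t *\<^sub>R u + (1 - t) *\<^sub>R v)"
  proof -
    have "u \<noteq> v"
      using less by auto
    with concave S t show ?thesis
      unfolding strictly_concave_on_def by simp
  qed
  finally show ?thesis .
qed

text \<open>
  When bid and ask of asset 1 agree, only the difference \<open>l1 - m1\<close> matters for the resulting
  portfolio. Once nothing of asset 1 is sold, its bid price is irrelevant.
\<close>
lemma net_asset1:
  assumes "(l1, l2, m1, m2) \<in> admissible z (a1, b2, a1, a2)" and "m1 \<le> l1"
  shows "(l1 - m1, l2, 0, m2) \<in> admissible z (b1, b2, a1, a2)"
    and "portfolio_after z (b1, b2, a1, a2) (l1 - m1, l2, 0, m2) =
      portfolio_after z (a1, b2, a1, a2) (l1, l2, m1, m2)"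
  using assms by (cases z; auto simp: algebra_simps)+

lemma raise_bid1:
  assumes mono: "strictly_increasing_each g" and le: "b1 \<le> b1'"
    and a: "a \<in> admissible z (b1, b2, a1, a2)"
  shows "a \<in> admissible z (b1', b2, a1, a2)"
    and "payoff g z (b1, b2, a1, a2) a \<le> payoff g z (b1', b2, a1, a2) a"
proof -
  obtain x y1 y2 l1 l2 m1 m2 where z: "z = (x, y1, y2)" and a_eq: "a = (l1, l2, m1, m2)"
    by (metis prod.exhaust)
  have "0 \<le> m1"
    using a by (simp add: z a_eq)
  then have revenue: "b1 * m1 \<le> b1' * m1"
    using le by (rule mult_right_mono[rotated])
  then show "a \<in> admissible z (b1', b2, a1, a2)"
    using a by (auto simp: z a_eq)
  have "mono_on {0..} (\<lambda>x. g (x, y1 - m1 + l1, y2 - m2 + l2))"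
    using mono a unfolding strictly_increasing_each_def
    by (intro strict_mono_on_imp_mono_on) (auto simp: z a_eq)
  then show "payoff g z (b1, b2, a1, a2) a \<le> payoff g z (b1', b2, a1, a2) a"
    using a revenue by (auto simp: z a_eq intro: mono_onD)
qed

text \<open>
  Strict positivity of \<open>l1\<close> is essential: it gives positive weight to a better trade that sells
  asset 1 on balance, when that trade is mixed with the given one to a net trade zero in asset 1.
  If \<open>l1\<close> were zero, then selling asset 1 could become worthwhile at the higher bid.
\<close>
lemma optimal_purchase_independent_of_bid1:
  assumes concave: "strictly_concave_on positions g" and mono: "strictly_increasing_each g"
    and le: "b1 \<le> a1" and l1: "0 < l1"
  shows "optimal_trade g z (b1, b2, a1, a2) (l1, l2, 0, m2) \<longleftrightarrow>
    optimal_trade g z (a1, b2, a1, a2) (l1, l2, 0, m2)"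
    (is "optimal_trade g z ?s ?a \<longleftrightarrow> optimal_trade g z ?s' ?a")
proof -
  have adm_eq: "?a \<in> admissible z ?s \<longleftrightarrow> ?a \<in> admissible z ?s'"
    and payoff_eq: "payoff g z ?s ?a = payoff g z ?s' ?a"
    by (cases z; simp)+
  show ?thesis
  proof
    assume "optimal_trade g z ?s' ?a"
    then show "optimal_trade g z ?s ?a"
      unfolding optimal_trade_def adm_eq payoff_eq
      using raise_bid1[OF mono le] by (meson order_trans)
  next
    assume opt: "optimal_trade g z ?s ?a"
    then have a: "?a \<in> admissible z ?s'"
      unfolding optimal_trade_def adm_eq by simp
    have net_buyer: "payoff g z ?s' (k1, k2, n1, n2) \<le> payoff g z ?s' ?a"
      if "(k1, k2, n1, n2) \<in> admissible z ?s'" "n1 \<le> k1" for k1 k2 n1 n2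
      using opt net_asset1[OF that] unfolding optimal_trade_def payoff_eq
      by (metis payoff_eq_portfolio_after)
    have "payoff g z ?s' a' \<le> payoff g z ?s' ?a" if a': "a' \<in> admissible z ?s'" for a'
    proof (rule ccontr)
      assume "\<not> payoff g z ?s' a' \<le> payoff g z ?s' ?a"
      then have better: "payoff g z ?s' ?a < payoff g z ?s' a'"
        by simp
      obtain k1 k2 n1 n2 where a'_eq: "a' = (k1, k2, n1, n2)"
        by (metis prod.exhaust)
      have sells: "k1 < n1"
        using net_buyer a' better unfolding a'_eq by (meson leD not_le)
      \<comment> \<open>This weight solves \<open>t * l1 + (1 - t) * (k1 - n1) = 0\<close>.\<close>
      define t where "t = (n1 - k1) / (l1 + (n1 - k1))"
      have t: "0 < t" "t < 1"
        using sells l1 by (auto simp: t_def field_simps)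
      have balance: "(1 - t) * n1 = t * l1 + (1 - t) * k1"
        using sells l1 by (simp add: t_def divide_simps) (simp add: algebra_simps)
      let ?c = "t *\<^sub>R ?a + (1 - t) *\<^sub>R a'"
      have "payoff g z ?s' ?a < payoff g z ?s' ?c"
        using strictly_concave_on_improves[OF concave portfolio_after_in_positions[OF a]
            portfolio_after_in_positions[OF a'] _ t] better
        unfolding payoff_eq_portfolio_after portfolio_after_convex_combination by simp
      moreover have "?c \<in> admissible z ?s'"
        using convexD[OF convex_admissible a a', of t "1 - t"] t by simp
      then have "payoff g z ?s' ?c \<le> payoff g z ?s' ?a"
        unfolding a'_eq using balance by (simp add: net_buyer)
      ultimately show False
        by simp
    qed
    then show "optimal_trade g z ?s' ?a"
      using a unfolding optimal_trade_def by simp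
  qed
qed

lemma admissible_dir_buy1_iff:
  "(l1, l2, m1, m2) \<in> admissible_dir (1, i) z s \<longleftrightarrow>
     (l1, l2, m1, m2) \<in> admissible z s \<and> 0 < l1 \<and> m1 = 0 \<and>
     real_of_int i = sgn (l2 - m2) \<and> l2 * m2 = 0"
proof (cases "(l1, l2, m1, m2) \<in> admissible z s")
  case True
  then have nonneg: "0 \<le> l1" "0 \<le> l2" "0 \<le> m1" "0 \<le> m2"
    by (cases z; cases s; simp)+
  then have "l1 * m1 + l2 * m2 = 0 \<longleftrightarrow> l1 * m1 = 0 \<and> l2 * m2 = 0"
    by (intro add_nonneg_eq_0_iff) auto
  with True nonneg show ?thesis
    by (auto simp: sgn_if split: if_splits)
qed simp

lemma admissible_dir_subset: "admissible_dir d z s \<subseteq> admissible z s"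
  by (cases d) auto

lemma trading_set_buy1_iff:
  "z \<in> trading_set g (1, i) s \<longleftrightarrow> z \<in> positions \<and>
     (\<exists>l1 l2 m2. 0 < l1 \<and> real_of_int i = sgn (l2 - m2) \<and> l2 * m2 = 0 \<and>
        optimal_trade g z s (l1, l2, 0, m2))"
proof -
  have optimal_in_dir:
    "a \<in> admissible_dir (1, i) z s \<and> value_fun g z s = payoff g z s a \<longleftrightarrow>
      a \<in> admissible_dir (1, i) z s \<and> optimal_trade g z s a" for a
    using value_fun_eq_payoff_iff_optimal_trade admissible_dir_subset by blast
  have "z \<in> trading_set g (1, i) s \<longleftrightarrow> z \<in> positions \<and>
      (\<exists>l1 l2 m1 m2. (l1, l2, m1, m2) \<in> admissible_dir (1, i) z s \<and>
         optimal_trade g z s (l1, l2, m1, m2))"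
    by (simp add: trading_set_def Bex_def optimal_in_dir del: admissible_dir.simps)
  then show ?thesis
    unfolding admissible_dir_buy1_iff by (auto simp: optimal_trade_def)
qed

theorem corollary6p8:
  fixes g :: "real \<times> real \<times> real \<Rightarrow> ereal"
    and b1 b2 a1 a2 :: real and i :: int
  assumes "\<forall>z \<in> positions. g z \<noteq> \<infinity>"
    and "strictly_concave_on positions g"
    and "strictly_increasing_each g"
    and "(b1, b2, a1, a2) \<in> price_domain"
    and "i \<in> {-1, 0, 1}"
  shows "trading_set g (1, i) (b1, b2, a1, a2) = trading_set g (1, i) (a1, b2, a1, a2)"
proof -
  have "b1 \<le> a1"
    using assms(4) by (simp add: price_domain_def)
  note bid1 = optimal_purchase_independent_of_bid1[OF assms(2,3) this]
  show ?thesis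
    by (intro set_eqI) (simp only: trading_set_buy1_iff bid1 cong: conj_cong)
qed

end
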